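(* Let $p\ge 2$ and $n\ge 1$ be integers, let $\Sigma$ be a real $p\times p$ symmetric positive definite matrix, and let $x_1,\dots,x_n$ be i.i.d. $N(0,\Sigma)$ random vectors in $\mathbb{R}^p$. Let $\widehat S=\frac1n\sum_{i=1}^n x_ix_i^T$, $\widehat F=\frac{\mathrm{Tr}(\widehat S)}{p}I_p$, $$\hat\rho_{LW}=\frac{\sum_{i=1}^n\|x_ix_i^T-\widehat S\|_F^2}{n^2\left[\mathrm{Tr}(\widehat S^2)-\mathrm{Tr}^2(\widehat S)/p\right]},\qquad \widehat\Sigma_{LW}=(1-\hat\rho_{LW})\widehat S+\hat\rho_{LW}\widehat F .$$ Then, almost surely, $$E\left[\widehat\Sigma_{LW}\mid \widehat S\right]=(1-\hat\rho_{RBLW})\widehat S+\hat\rho_{RBLW}\widehat F,\qquad \hat\rho_{RBLW}=\frac{\frac{n-2}{n}\mathrm{Tr}(\widehat S^2)+\mathrm{Tr}^2(\widehat S)}{(n+2)\left[\mathrm{Tr}(\widehat S^2)-\mathrm{Tr}^2(\widehat S)/p\right]}.$$ Moreover, writing $\widehat\Sigma_{RBLW}=(1-\hat\rho_{RBLW})\widehat S+\hat\rho_{RBLW}\widehat F$, for every such $\Sigma$, $$E\{\|\widehat\Sigma_{RBLW}-\Sigma\|_F^2\}\le E\{\|\widehat\Sigma_{LW}-\Sigma\|_F^2\}.$$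
   Context: $\|\cdot\|_F$ is the Frobenius norm, $\mathrm{Tr}$ the trace, and $\mathrm{Tr}^2(A)=(\mathrm{Tr}(A))^2$. The denominator $\mathrm{Tr}(\widehat S^2)-\mathrm{Tr}^2(\widehat S)/p$ is almost surely positive under these assumptions. $\widehat\Sigma_{LW}$ is the (unclipped) Ledoit–Wolf estimator. *)

theory Defs
  imports "HOL-Analysis.Analysis" "HOL-Probability.Probability"
begin

definition mtrace :: "real^'p^'p \<Rightarrow> real" where
  "mtrace A = (\<Sum>i\<in>UNIV. A $ i $ i)"

definition frob :: "real^'p^'q \<Rightarrow> real" where
  "frob A = sqrt (\<Sum>i\<in>UNIV. \<Sum>j\<in>UNIV. (A $ i $ j)^2)"

definition outer :: "real^'p \<Rightarrow> real^'p \<Rightarrow> real^'p^'p" where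
  "outer x y = (\<chi> i j. x $ i * y $ j)"

definition sym_posdef :: "real^'p^'p \<Rightarrow> bool" where
  "sym_posdef S \<longleftrightarrow> transpose S = S \<and> (\<forall>v. v \<noteq> 0 \<longrightarrow> v \<bullet> (S *v v) > 0)"

definition mvn_density :: "real^'p^'p \<Rightarrow> real^'p \<Rightarrow> real" where
  "mvn_density Sig x =
     exp (- (x \<bullet> (matrix_inv Sig *v x)) / 2) / sqrt ((2 * pi) ^ CARD('p) * det Sig)"

definition Shat :: "nat \<Rightarrow> (nat \<Rightarrow> 'a \<Rightarrow> real^'p) \<Rightarrow> 'a \<Rightarrow> real^'p^'p" where
  "Shat n X \<omega> = (1 / real n) *\<^sub>R (\<Sum>i<n. outer (X i \<omega>) (X i \<omega>))"

definition Fhat :: "real^'p^'p \<Rightarrow> real^'p^'p" where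
  "Fhat S = (mtrace S / real CARD('p)) *\<^sub>R mat 1"

definition rho_LW :: "nat \<Rightarrow> (nat \<Rightarrow> 'a \<Rightarrow> real^'p) \<Rightarrow> 'a \<Rightarrow> real" where
  "rho_LW n X \<omega> =
     (let S = Shat n X \<omega> in
      (\<Sum>i<n. (frob (outer (X i \<omega>) (X i \<omega>) - S))^2)
      / ((real n)^2 * (mtrace (S ** S) - (mtrace S)^2 / real CARD('p))))"

definition Sigma_LW :: "nat \<Rightarrow> (nat \<Rightarrow> 'a \<Rightarrow> real^'p) \<Rightarrow> 'a \<Rightarrow> real^'p^'p" where
  "Sigma_LW n X \<omega> =
     (let S = Shat n X \<omega>; r = rho_LW n X \<omega> in (1 - r) *\<^sub>R S + r *\<^sub>R Fhat S)"

definition rho_RBLW :: "nat \<Rightarrow> real^'p^'p \<Rightarrow> real" where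
  "rho_RBLW n S =
     ((real n - 2) / real n * mtrace (S ** S) + (mtrace S)^2)
     / ((real n + 2) * (mtrace (S ** S) - (mtrace S)^2 / real CARD('p)))"

definition Sigma_RBLW :: "nat \<Rightarrow> (nat \<Rightarrow> 'a \<Rightarrow> real^'p) \<Rightarrow> 'a \<Rightarrow> real^'p^'p" where
  "Sigma_RBLW n X \<omega> =
     (let S = Shat n X \<omega>; r = rho_RBLW n S in (1 - r) *\<^sub>R S + r *\<^sub>R Fhat S)"

end

theory Submission
  imports Defs
begin

text \<open>
  The joint law of the sample is invariant under a 45 degree rotation
  \<open>(x\<^sub>i, x\<^sub>j) \<mapsto> ((x\<^sub>i + x\<^sub>j) / \<surd>2, (x\<^sub>i - x\<^sub>j) / \<surd>2)\<close> of two observations, and such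
  rotations do not change the sample covariance \<open>S\<close>. Expanding the fourth powers of the norms of
  the rotated vectors gives, for \<open>i \<noteq> j\<close>,
  \<open>E[\<bar>x\<^sub>i\<bar>\<^sup>4 + \<bar>x\<^sub>j\<bar>\<^sup>4 | S] = E[2 \<bar>x\<^sub>i\<bar>\<^sup>2 \<bar>x\<^sub>j\<bar>\<^sup>2 + 4 (x\<^sub>i \<bullet> x\<^sub>j)\<^sup>2 | S]\<close>,
  and summation over all pairs expresses \<open>E[\<Sum>\<^sub>i \<bar>x\<^sub>i\<bar>\<^sup>4 | S]\<close> by \<open>Tr(S)\<^sup>2\<close> and \<open>Tr(S\<^sup>2)\<close>.
  The estimator is affine in \<open>\<Sum>\<^sub>i \<bar>x\<^sub>i\<bar>\<^sup>4\<close> with coefficients depending on \<open>S\<close> only;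
  the risk bound is the conditional Jensen inequality, entry by entry.
\<close>

subsection \<open>Rotating two independent components\<close>

text \<open>Up to the sign of component \<open>j\<close> this is the 45 degree rotation in
  components \<open>i\<close> and \<open>j\<close>. It is defined on whole families so that it can
  act on the joint law; both new values are formed from the old \<open>x\<close>.\<close>

definition rot45 :: "'i \<Rightarrow> 'i \<Rightarrow> ('i \<Rightarrow> 'b::real_vector) \<Rightarrow> 'i \<Rightarrow> 'b" where
  "rot45 i j x = x(i := (1 / sqrt 2) *\<^sub>R (x i + x j), j := (1 / sqrt 2) *\<^sub>R (x i - x j))"

lemma nn_integral_lborel_affine:
  fixes t :: "'b::euclidean_space"
  assumes [measurable]: "f \<in> borel_measurable borel" and c: "c \<noteq> 0"
  shows "(\<integral>\<^sup>+x. f x \<partial>lborel) = ennreal (\<bar>c\<bar> ^ DIM('b)) * (\<integral>\<^sup>+x. f (t + c *\<^sub>R x) \<partial>lborel)"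
  by (subst lborel_affine[OF c, of t])
     (simp add: nn_integral_density nn_integral_distr nn_integral_cmult)

text \<open>The change of variables is split into two affine substitutions in one block each: u = (x
  + y) / sqrt 2 for fixed y, then v = u - sqrt 2 y for fixed u. The first produces the factor
  \<open>?c\<close> and the second absorbs it.\<close>

lemma nn_integral_lborel_rot45:
  fixes g :: "'b::euclidean_space \<times> 'b \<Rightarrow> ennreal"
  assumes [measurable]: "g \<in> borel_measurable (borel \<Otimes>\<^sub>M borel)"
  shows "(\<integral>\<^sup>+x. \<integral>\<^sup>+y. g ((1 / sqrt 2) *\<^sub>R (x + y), (1 / sqrt 2) *\<^sub>R (x - y)) \<partial>lborel \<partial>lborel)
       = (\<integral>\<^sup>+x. \<integral>\<^sup>+y. g (x, y) \<partial>lborel \<partial>lborel)"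
proof -
  let ?s = "1 / sqrt 2 :: real"
  let ?c = "ennreal (sqrt 2 ^ DIM('b))"
  have "(\<integral>\<^sup>+x. \<integral>\<^sup>+y. g (?s *\<^sub>R (x + y), ?s *\<^sub>R (x - y)) \<partial>lborel \<partial>lborel)
      = (\<integral>\<^sup>+y. \<integral>\<^sup>+x. g (?s *\<^sub>R (x + y), ?s *\<^sub>R (x - y)) \<partial>lborel \<partial>lborel)"
    by (rule lborel_pair.Fubini'[symmetric]) measurable
  also have "\<dots> = (\<integral>\<^sup>+y. ?c * (\<integral>\<^sup>+u. g (u, u - sqrt 2 *\<^sub>R y) \<partial>lborel) \<partial>lborel)"
  proof (rule nn_integral_cong)
    fix y :: 'b
    have 1: "?s *\<^sub>R (- y + sqrt 2 *\<^sub>R u + y) = u" for u :: 'b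
      by simp
    have 2: "?s *\<^sub>R (- y + sqrt 2 *\<^sub>R u - y) = u - sqrt 2 *\<^sub>R y" for u :: 'b
    proof -
      have "- y + sqrt 2 *\<^sub>R u - y = sqrt 2 *\<^sub>R (u - sqrt 2 *\<^sub>R y)"
        by (simp add: scaleR_diff_right scaleR_2)
      then show ?thesis by simp
    qed
    show "(\<integral>\<^sup>+x. g (?s *\<^sub>R (x + y), ?s *\<^sub>R (x - y)) \<partial>lborel)
        = ?c * (\<integral>\<^sup>+u. g (u, u - sqrt 2 *\<^sub>R y) \<partial>lborel)"
      by (subst nn_integral_lborel_affine[where t="- y" and c="sqrt 2"]) (simp, simp, simp only: 1 2, simp)
  qed
  also have "\<dots> = ?c * (\<integral>\<^sup>+y. \<integral>\<^sup>+u. g (u, u - sqrt 2 *\<^sub>R y) \<partial>lborel \<partial>lborel)"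
    by (rule nn_integral_cmult) measurable
  also have "\<dots> = ?c * (\<integral>\<^sup>+u. \<integral>\<^sup>+y. g (u, u - sqrt 2 *\<^sub>R y) \<partial>lborel \<partial>lborel)"
    by (subst lborel_pair.Fubini') auto
  also have "\<dots> = (\<integral>\<^sup>+u. ?c * (\<integral>\<^sup>+y. g (u, u - sqrt 2 *\<^sub>R y) \<partial>lborel) \<partial>lborel)"
    by (rule nn_integral_cmult[symmetric]) measurable
  also have "\<dots> = (\<integral>\<^sup>+x. \<integral>\<^sup>+y. g (x, y) \<partial>lborel \<partial>lborel)"
  proof (rule nn_integral_cong)
    fix u :: 'b
    show "?c * (\<integral>\<^sup>+y. g (u, u - sqrt 2 *\<^sub>R y) \<partial>lborel) = (\<integral>\<^sup>+y. g (u, y) \<partial>lborel)"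
      by (subst (2) nn_integral_lborel_affine[where t="u" and c="- sqrt 2"]) simp_all
  qed
  finally show ?thesis .
qed

text \<open>Hypothesis \<open>f\<close> says that the product density is constant along the
  rotation, so the densities can be moved into the integrand and the Lebesgue case applies.
  Normality of the sample enters through this equation.\<close>

lemma nn_integral_density_rot45:
  fixes g :: "'b::euclidean_space \<times> 'b \<Rightarrow> ennreal"
  assumes [measurable]: "g \<in> borel_measurable (borel \<Otimes>\<^sub>M borel)" "f \<in> borel_measurable borel"
    and f: "\<And>x y. f ((1 / sqrt 2) *\<^sub>R (x + y)) * f ((1 / sqrt 2) *\<^sub>R (x - y)) = f x * f y"
  shows "(\<integral>\<^sup>+x. \<integral>\<^sup>+y. g ((1 / sqrt 2) *\<^sub>R (x + y), (1 / sqrt 2) *\<^sub>R (x - y))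
             \<partial>density lborel f \<partial>density lborel f)
       = (\<integral>\<^sup>+x. \<integral>\<^sup>+y. g (x, y) \<partial>density lborel f \<partial>density lborel f)"
proof -
  have *: "(\<integral>\<^sup>+x. \<integral>\<^sup>+y. h (x, y) \<partial>density lborel f \<partial>density lborel f)
     = (\<integral>\<^sup>+x. \<integral>\<^sup>+y. f x * f y * h (x, y) \<partial>lborel \<partial>lborel)"
    if [measurable]: "h \<in> borel_measurable (borel \<Otimes>\<^sub>M borel)" for h :: "'b \<times> 'b \<Rightarrow> ennreal"
    by (simp add: nn_integral_density nn_integral_cmult mult.assoc)
  let ?h = "\<lambda>(x, y). f x * f y * g (x, y)"
  have "(\<integral>\<^sup>+x. \<integral>\<^sup>+y. ?h ((1 / sqrt 2) *\<^sub>R (x + y), (1 / sqrt 2) *\<^sub>R (x - y)) \<partial>lborel \<partial>lborel)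
      = (\<integral>\<^sup>+x. \<integral>\<^sup>+y. ?h (x, y) \<partial>lborel \<partial>lborel)"
    by (rule nn_integral_lborel_rot45) measurable
  then show ?thesis
    using *[of g] *[of "\<lambda>(x, y). g ((1 / sqrt 2) *\<^sub>R (x + y), (1 / sqrt 2) *\<^sub>R (x - y))"]
    by (simp add: f)
qed

lemma measurable_rot45:
  assumes "i \<in> I" "j \<in> I"
  shows "rot45 i j \<in> measurable (PiM I (\<lambda>_. borel)) (PiM I (\<lambda>_. borel :: 'b::euclidean_space measure))"
  unfolding rot45_def using assms
  by (intro measurable_fun_upd[where J=I] measurable_fun_upd[where J=I and I=I]) auto

text \<open>By Fubini, components \<open>i\<close> and \<open>j\<close> can be integrated innermost;
  for fixed values \<open>z\<close> of the others the claim is the two-variable invariance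
  above.\<close>

lemma distr_PiM_rot45:
  fixes f :: "'b::euclidean_space \<Rightarrow> ennreal"
  assumes [measurable]: "f \<in> borel_measurable borel"
    and N: "prob_space (density lborel f)"
    and f: "\<And>x y. f ((1 / sqrt 2) *\<^sub>R (x + y)) * f ((1 / sqrt 2) *\<^sub>R (x - y)) = f x * f y"
    and I: "finite I" "i \<in> I" "j \<in> I" "i \<noteq> j"
  shows "distr (PiM I (\<lambda>_. density lborel f)) (PiM I (\<lambda>_. borel)) (rot45 i j)
       = PiM I (\<lambda>_. density lborel f)"
proof (rule measure_eqI)
  let ?N = "density lborel f"
  let ?P = "PiM I (\<lambda>_. ?N)"
  interpret N: prob_space ?N by fact
  interpret P: product_prob_space "\<lambda>_. ?N" ..
  have sets_eq: "sets ?P = sets (PiM I (\<lambda>_. borel))"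
    by (intro sets_PiM_cong) auto
  show "sets (distr ?P (PiM I (\<lambda>_. borel)) (rot45 i j)) = sets ?P"
    by (simp add: sets_eq)
  have [measurable]: "rot45 i j \<in> measurable ?P (PiM I (\<lambda>_. borel))"
    using measurable_rot45[OF I(2,3)] by (simp cong: measurable_cong_sets add: sets_eq)
  define J where "J = I - {i, j}"
  have J: "I = insert i (insert j J)" "finite J" "i \<notin> insert j J" "j \<notin> J"
    using I by (auto simp: J_def)
  have expand: "(\<integral>\<^sup>+x. h x \<partial>?P) = (\<integral>\<^sup>+z. \<integral>\<^sup>+y. \<integral>\<^sup>+x. h (z(j := y, i := x)) \<partial>?N \<partial>?N \<partial>PiM J (\<lambda>_. ?N))"
    if h: "h \<in> borel_measurable ?P" for h :: "_ \<Rightarrow> ennreal"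
  proof -
    have h': "h \<in> borel_measurable (PiM (insert i (insert j J)) (\<lambda>_. ?N))"
      using h J(1) by simp
    have m: "(\<lambda>w. \<integral>\<^sup>+x. h (w(i := x)) \<partial>?N) \<in> borel_measurable (PiM (insert j J) (\<lambda>_. ?N))"
    proof -
      have "(\<lambda>(w, x). h (w(i := x))) \<in> borel_measurable (PiM (insert j J) (\<lambda>_. ?N) \<Otimes>\<^sub>M ?N)"
        unfolding split_beta
        by (rule measurable_compose[OF _ h'], rule measurable_fun_upd[where J="insert j J"]) auto
      then show ?thesis by measurable
    qed
    have "(\<integral>\<^sup>+x. h x \<partial>?P) = (\<integral>\<^sup>+w. \<integral>\<^sup>+x. h (w(i := x)) \<partial>?N \<partial>PiM (insert j J) (\<lambda>_. ?N))"
      unfolding J(1) by (rule P.product_nn_integral_insert) (use J h' in auto)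
    also have "\<dots> = (\<integral>\<^sup>+z. \<integral>\<^sup>+y. \<integral>\<^sup>+x. h (z(j := y, i := x)) \<partial>?N \<partial>?N \<partial>PiM J (\<lambda>_. ?N))"
      by (rule P.product_nn_integral_insert) (use J m in auto)
    finally show ?thesis .
  qed
  fix A assume "A \<in> sets (distr ?P (PiM I (\<lambda>_. borel)) (rot45 i j))"
  then have A: "A \<in> sets (PiM I (\<lambda>_. borel))" by simp
  then have [measurable]: "indicator A \<in> borel_measurable (PiM I (\<lambda>_. borel))"
    by simp
  have AP: "A \<in> sets ?P" using A by (simp add: sets_eq)
  have "emeasure (distr ?P (PiM I (\<lambda>_. borel)) (rot45 i j)) A
      = (\<integral>\<^sup>+x. indicator A (rot45 i j x) \<partial>?P)"
    using A by (simp add: nn_integral_distr flip: nn_integral_indicator)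
  also have "\<dots> = (\<integral>\<^sup>+z. \<integral>\<^sup>+y. \<integral>\<^sup>+x. indicator A (rot45 i j (z(j := y, i := x))) \<partial>?N \<partial>?N \<partial>PiM J (\<lambda>_. ?N))"
    by (rule expand) measurable
  also have "\<dots> = (\<integral>\<^sup>+z. \<integral>\<^sup>+y. \<integral>\<^sup>+x. indicator A (z(j := y, i := x)) \<partial>?N \<partial>?N \<partial>PiM J (\<lambda>_. ?N))"
  proof (rule nn_integral_cong)
    fix z assume z: "z \<in> space (PiM J (\<lambda>_. ?N))"
    let ?g = "\<lambda>(x, y). indicator A (z(j := y, i := x)) :: ennreal"
    have g[measurable]: "?g \<in> borel_measurable (borel \<Otimes>\<^sub>M borel)"
    proof -
      have z': "z \<in> space (PiM J (\<lambda>_. borel))" using z by (simp add: space_PiM)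
      have "(\<lambda>p. z(j := snd p, i := fst p)) \<in> measurable (borel \<Otimes>\<^sub>M borel) (PiM I (\<lambda>_. borel))"
        by (rule measurable_fun_upd[where J="insert j J"])
           (use J z' in \<open>auto intro!: measurable_fun_upd[where J=J]\<close>)
      then show ?thesis unfolding split_beta by measurable
    qed
    interpret NN: pair_sigma_finite ?N ?N ..
    have g': "(\<lambda>(x, y). ?g ((1 / sqrt 2) *\<^sub>R (x + y), (1 / sqrt 2) *\<^sub>R (x - y))) \<in> borel_measurable (?N \<Otimes>\<^sub>M ?N)"
    proof -
      have "(\<lambda>(x, y). ?g ((1 / sqrt 2) *\<^sub>R (x + y), (1 / sqrt 2) *\<^sub>R (x - y))) \<in> borel_measurable (borel \<Otimes>\<^sub>M borel)"
        unfolding split_beta by measurable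
      then show ?thesis by (simp cong: measurable_cong_sets)
    qed
    have gN: "?g \<in> borel_measurable (?N \<Otimes>\<^sub>M ?N)"
      using g by (simp cong: measurable_cong_sets)
    have eq: "rot45 i j (z(j := y, i := x)) = z(j := (1 / sqrt 2) *\<^sub>R (x - y), i := (1 / sqrt 2) *\<^sub>R (x + y))" for x y
      using \<open>i \<noteq> j\<close> by (auto simp: rot45_def)
    have "(\<integral>\<^sup>+y. \<integral>\<^sup>+x. indicator A (rot45 i j (z(j := y, i := x))) \<partial>?N \<partial>?N)
        = (\<integral>\<^sup>+y. \<integral>\<^sup>+x. ?g ((1 / sqrt 2) *\<^sub>R (x + y), (1 / sqrt 2) *\<^sub>R (x - y)) \<partial>?N \<partial>?N)"
      by (simp add: eq)
    \<comment> \<open>\<open>expand\<close> has component \<open>i\<close> innermost, while the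
      two-variable invariance has it outermost; hence a swap here and another one
      afterwards.\<close>
    also have "\<dots> = (\<integral>\<^sup>+x. \<integral>\<^sup>+y. ?g ((1 / sqrt 2) *\<^sub>R (x + y), (1 / sqrt 2) *\<^sub>R (x - y)) \<partial>?N \<partial>?N)"
      using NN.Fubini'[OF g'] by simp
    also have "\<dots> = (\<integral>\<^sup>+x. \<integral>\<^sup>+y. ?g (x, y) \<partial>?N \<partial>?N)"
      by (rule nn_integral_density_rot45[OF g]) (simp_all add: f)
    also have "\<dots> = (\<integral>\<^sup>+y. \<integral>\<^sup>+x. ?g (x, y) \<partial>?N \<partial>?N)"
      using NN.Fubini'[OF gN] by simp
    finally show "(\<integral>\<^sup>+y. \<integral>\<^sup>+x. indicator A (rot45 i j (z(j := y, i := x))) \<partial>?N \<partial>?N)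
        = (\<integral>\<^sup>+y. \<integral>\<^sup>+x. indicator A (z(j := y, i := x)) \<partial>?N \<partial>?N)" by simp
  qed
  also have "\<dots> = (\<integral>\<^sup>+x. indicator A x \<partial>?P)"
    by (rule expand[symmetric]) (use AP in simp)
  also have "\<dots> = emeasure ?P A" using AP by simp
  finally show "emeasure (distr ?P (PiM I (\<lambda>_. borel)) (rot45 i j)) A = emeasure ?P A" .
qed

subsection \<open>Sample covariance and its traces\<close>

lemma mtrace_Shat: "mtrace (Shat n X \<omega>) = (\<Sum>i<n. (norm (X i \<omega>))\<^sup>2) / n"
  by (simp add: mtrace_def Shat_def outer_def power2_norm_eq_inner inner_vec_def sum_distrib_left
      sum.swap[of _ UNIV "{..<n}"] sum_divide_distrib)

text \<open>Tr(x x^T y y^T) = (x . y)^2, applied to all pairs of terms of the two sums.\<close>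

lemma mtrace_Shat_sq:
  "mtrace (Shat n X \<omega> ** Shat n X \<omega>) = (\<Sum>i<n. \<Sum>j<n. (X i \<omega> \<bullet> X j \<omega>)\<^sup>2) / (real n)\<^sup>2"
proof -
  have "mtrace (Shat n X \<omega> ** Shat n X \<omega>)
     = (\<Sum>a\<in>UNIV. \<Sum>b\<in>UNIV. (\<Sum>i<n. X i \<omega> $ a * X i \<omega> $ b) * (\<Sum>j<n. X j \<omega> $ b * X j \<omega> $ a)) / (real n)\<^sup>2"
    by (simp add: mtrace_def Shat_def outer_def matrix_matrix_mult_def power2_eq_square flip: sum_divide_distrib)
  also have "(\<Sum>a\<in>UNIV. \<Sum>b\<in>UNIV. (\<Sum>i<n. X i \<omega> $ a * X i \<omega> $ b) * (\<Sum>j<n. X j \<omega> $ b * X j \<omega> $ a))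
     = (\<Sum>a\<in>UNIV. \<Sum>b\<in>UNIV. \<Sum>i<n. \<Sum>j<n. (X i \<omega> $ a * X j \<omega> $ a) * (X i \<omega> $ b * X j \<omega> $ b))"
    by (simp add: sum_product mult_ac)
  also have "\<dots> = (\<Sum>i<n. \<Sum>j<n. \<Sum>a\<in>UNIV. \<Sum>b\<in>UNIV. (X i \<omega> $ a * X j \<omega> $ a) * (X i \<omega> $ b * X j \<omega> $ b))"
    by (simp add: sum.swap[of _ UNIV "{..<n}"])
  also have "\<dots> = (\<Sum>i<n. \<Sum>j<n. (X i \<omega> \<bullet> X j \<omega>)\<^sup>2)"
    by (simp add: inner_vec_def power2_eq_square sum_product)
  finally show ?thesis .
qed

lemma frob_sq: "(frob A)\<^sup>2 = (\<Sum>i\<in>UNIV. \<Sum>j\<in>UNIV. (A $ i $ j)\<^sup>2)"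
  by (simp add: frob_def sum_nonneg)

lemma Shat_sym: "Shat n X \<omega> $ a $ b = Shat n X \<omega> $ b $ a"
  by (simp add: Shat_def outer_def mult.commute)

text \<open>Entry by entry, squared deviations from a mean add up to the sum of squares minus n
  times the squared mean. The squared Frobenius norm of x x^T is |x|^4, and that of the symmetric S
  is Tr(S^2). Thus the numerator of \<open>rho_LW\<close> depends on the sample only through S and
  the sum of fourth powers.\<close>

lemma sum_frob_outer_diff_Shat:
  "(\<Sum>i<n. (frob (outer (X i \<omega>) (X i \<omega>) - Shat n X \<omega>))\<^sup>2)
     = (\<Sum>i<n. norm (X i \<omega>) ^ 4) - n * mtrace (Shat n X \<omega> ** Shat n X \<omega>)"
proof (cases "n = 0")
  case False
  let ?S = "Shat n X \<omega>"
  have e: "(\<Sum>i<n. X i \<omega> $ a * X i \<omega> $ b) = n * ?S $ a $ b" for a b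
    using False by (simp add: Shat_def outer_def)
  have n4: "norm (X i \<omega>) ^ 4 = (\<Sum>a\<in>UNIV. \<Sum>b\<in>UNIV. (X i \<omega> $ a * X i \<omega> $ b)\<^sup>2)" for i
  proof -
    have "norm (X i \<omega>) ^ 4 = ((norm (X i \<omega>))\<^sup>2)\<^sup>2" by simp
    also have "\<dots> = (\<Sum>a\<in>UNIV. \<Sum>b\<in>UNIV. (X i \<omega> $ a * X i \<omega> $ b)\<^sup>2)"
      unfolding power2_norm_eq_inner inner_vec_def
      by (simp add: power2_eq_square sum_product mult_ac)
    finally show ?thesis .
  qed
  have tr: "mtrace (?S ** ?S) = (\<Sum>a\<in>UNIV. \<Sum>b\<in>UNIV. (?S $ a $ b)\<^sup>2)"
    by (simp add: mtrace_def matrix_matrix_mult_def power2_eq_square Shat_sym[of n X \<omega>])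
  have "(\<Sum>i<n. (frob (outer (X i \<omega>) (X i \<omega>) - ?S))\<^sup>2)
      = (\<Sum>a\<in>UNIV. \<Sum>b\<in>UNIV. \<Sum>i<n. (X i \<omega> $ a * X i \<omega> $ b - ?S $ a $ b)\<^sup>2)"
    by (simp add: frob_sq outer_def sum.swap[of _ UNIV "{..<n}"])
  also have "\<dots> = (\<Sum>a\<in>UNIV. \<Sum>b\<in>UNIV. (\<Sum>i<n. (X i \<omega> $ a * X i \<omega> $ b)\<^sup>2) - n * (?S $ a $ b)\<^sup>2)"
  proof (intro sum.cong refl)
    fix a b
    have "(\<Sum>i<n. (X i \<omega> $ a * X i \<omega> $ b - ?S $ a $ b)\<^sup>2)
       = (\<Sum>i<n. (X i \<omega> $ a * X i \<omega> $ b)\<^sup>2) + n * (?S $ a $ b)\<^sup>2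
          - 2 * ?S $ a $ b * (\<Sum>i<n. X i \<omega> $ a * X i \<omega> $ b)"
      by (simp add: power2_diff sum.distrib sum_subtractf sum_distrib_left mult_ac)
    then show "(\<Sum>i<n. (X i \<omega> $ a * X i \<omega> $ b - ?S $ a $ b)\<^sup>2)
       = (\<Sum>i<n. (X i \<omega> $ a * X i \<omega> $ b)\<^sup>2) - n * (?S $ a $ b)\<^sup>2"
      unfolding e by (simp add: power2_eq_square algebra_simps)
  qed
  also have "\<dots> = (\<Sum>i<n. norm (X i \<omega>) ^ 4) - n * mtrace (?S ** ?S)"
    by (simp add: n4 tr sum_subtractf sum_distrib_left sum.swap[of _ UNIV "{..<n}"])
  finally show ?thesis .
qed simp

section \<open>Measurability of the sample covariance and its traces\<close>

lemma borel_measurable_matrix_entry [measurable]: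
  "(\<lambda>S :: real^'p^'q. S $ i $ j) \<in> borel_measurable borel"
  by (intro borel_measurable_continuous_onI continuous_intros)

lemma borel_measurable_mtrace [measurable]: "mtrace \<in> borel_measurable borel"
  unfolding mtrace_def[abs_def] by measurable

lemma borel_measurable_mtrace_sq [measurable]: "(\<lambda>S. mtrace (S ** S)) \<in> borel_measurable borel"
  unfolding mtrace_def matrix_matrix_mult_def by simp

lemma borel_measurable_Shat [measurable]:
  assumes "\<And>i. i < n \<Longrightarrow> X i \<in> borel_measurable M"
  shows "Shat n X \<in> borel_measurable M"
proof -
  have "(\<lambda>x :: real^'b. outer x x) \<in> borel_measurable borel"
    unfolding outer_def
    by (intro borel_measurable_continuous_onI continuous_on_vec_lambda continuous_intros)
  then show ?thesis
    unfolding Shat_def[abs_def] using assms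
    by (intro borel_measurable_scaleR borel_measurable_sum borel_measurable_const) (auto intro: measurable_compose)
qed

section \<open>Effect of the rotation on outer products and fourth powers\<close>

lemma outer_rot45:
  "outer ((1 / sqrt 2) *\<^sub>R (x + y)) ((1 / sqrt 2) *\<^sub>R (x + y))
   + outer ((1 / sqrt 2) *\<^sub>R (x - y)) ((1 / sqrt 2) *\<^sub>R (x - y)) = outer x x + outer y y"
  by (simp add: outer_def vec_eq_iff algebra_simps add_divide_distrib diff_divide_distrib)

text \<open>The squared norms of the new vectors are (A + B) / 2 and (A - B) / 2 with A = |x|^2 +
  |y|^2 and B = 2 x . y, and their squares add up to (A^2 + B^2) / 2.\<close>

lemma norm4_rot45:
  fixes x y :: "'b::real_inner"
  shows "norm ((1 / sqrt 2) *\<^sub>R (x + y)) ^ 4 + norm ((1 / sqrt 2) *\<^sub>R (x - y)) ^ 4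
    = (norm x ^ 4 + norm y ^ 4 + 2 * (norm x)\<^sup>2 * (norm y)\<^sup>2 + 4 * (x \<bullet> y)\<^sup>2) / 2"
proof -
  have n4: "norm v ^ 4 = (v \<bullet> v)\<^sup>2" for v :: 'b
    by (simp add: power2_norm_eq_inner[symmetric])
  show ?thesis unfolding n4 unfolding power2_norm_eq_inner
    by (simp add: inner_add_left inner_add_right inner_diff_left inner_diff_right inner_commute[of y x] field_simps power2_eq_square)
qed

subsection \<open>Conditional expectation\<close>

context sigma_finite_subalgebra
begin

text \<open>\<open>real_cond_exp\<close> is the difference of the nonnegative conditional
  expectations of the positive and negative parts. The indicator can be pulled out of each of these,
  whether or not \<open>f\<close> is integrable.\<close>

lemma real_cond_exp_indicator_mult:
  assumes A: "A \<in> sets F" and [measurable]: "f \<in> borel_measurable M"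
  shows "AE x in M. real_cond_exp M F (\<lambda>x. indicator A x * f x) x = indicator A x * real_cond_exp M F f x"
proof -
  have 1: "ennreal (indicator A x * g x) = indicator A x * ennreal (g x)"
    "ennreal (- (indicator A x * g x)) = indicator A x * ennreal (- g x)" for g :: "'a \<Rightarrow> real" and x
    by (auto simp: indicator_def)
  have "AE x in M. indicator A x * nn_cond_exp M F (\<lambda>x. ennreal (f x)) x
          = nn_cond_exp M F (\<lambda>x. indicator A x * ennreal (f x)) x"
    by (rule nn_cond_exp_prod) (use A in auto)
  moreover have "AE x in M. indicator A x * nn_cond_exp M F (\<lambda>x. ennreal (- f x)) x
          = nn_cond_exp M F (\<lambda>x. indicator A x * ennreal (- f x)) x"
    by (rule nn_cond_exp_prod) (use A in auto)
  ultimately show ?thesis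
  proof eventually_elim
    case (elim x)
    then show ?case
      unfolding real_cond_exp_def 1 by (auto simp: indicator_def split: if_splits simp flip: elim)
  qed
qed

text \<open>
  The junk value of \<^const>\<open>real_cond_exp\<close> on functions that are not integrable is still determined by the
  restrictions to sets of \<open>F\<close>, so integrability is only needed on a countable cover.
\<close>

lemma real_cond_exp_charact_local:
  fixes A :: "nat \<Rightarrow> 'a set"
  assumes [measurable]: "f \<in> borel_measurable M" "g \<in> borel_measurable F"
    and A: "\<And>k. A k \<in> sets F" "(\<Union>k. A k) = space M"
    and int: "\<And>k. integrable M (\<lambda>x. indicator (A k) x * f x)" "\<And>k. integrable M (\<lambda>x. indicator (A k) x * g x)"
    and eq: "\<And>k B. B \<in> sets F \<Longrightarrow> B \<subseteq> A k \<Longrightarrow> (\<integral>x. indicator B x * f x \<partial>M) = (\<integral>x. indicator B x * g x \<partial>M)"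
  shows "AE x in M. real_cond_exp M F f x = g x"
proof -
  have "AE x in M. indicator (A k) x * real_cond_exp M F f x = indicator (A k) x * g x" for k
  proof -
    note [measurable] = A(1)
    have "AE x in M. real_cond_exp M F (\<lambda>x. indicator (A k) x * f x) x = indicator (A k) x * g x"
    proof (rule real_cond_exp_charact)
      fix B assume [measurable]: "B \<in> sets F"
      \<comment> \<open>Testing the truncated functions on \<open>B\<close> is testing
        \<open>f\<close> and \<open>g\<close> on \<open>B \<inter> A k\<close>, which
        \<open>eq\<close> covers.\<close>
      have "(\<integral>x. indicator (B \<inter> A k) x * f x \<partial>M) = (\<integral>x. indicator (B \<inter> A k) x * g x \<partial>M)"
        by (rule eq[where k=k]) auto
      then show "(\<integral>x\<in>B. indicator (A k) x * f x \<partial>M) = (\<integral>x\<in>B. indicator (A k) x * g x \<partial>M)"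
        by (simp add: set_lebesgue_integral_def indicator_inter_arith mult.assoc)
    qed (use int in auto)
    with real_cond_exp_indicator_mult[OF A(1)[of k] assms(1)] show ?thesis
      by eventually_elim auto
  qed
  then have "AE x in M. \<forall>k. indicator (A k) x * real_cond_exp M F f x = indicator (A k) x * g x"
    unfolding AE_all_countable by blast
  with AE_space show ?thesis
  proof eventually_elim
    case (elim x)
    then obtain k where "x \<in> A k" using A(2) by auto
    with elim show ?case by (auto dest: spec[of _ k])
  qed
qed

text \<open>If the right side is infinite there is nothing to show. Otherwise \<open>f\<close> is
  square integrable about \<open>c\<close>, hence integrable because the measure is finite, and
  conditional Jensen applies to (y - c)^2. Integrals with values in [0, \<infinity>] leave room for
  an infinite risk.\<close>

lemma nn_integral_real_cond_exp_diff_sq_le: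
  assumes [measurable]: "f \<in> borel_measurable M" and fin: "finite_measure M"
  shows "(\<integral>\<^sup>+x. ennreal ((real_cond_exp M F f x - c)\<^sup>2) \<partial>M) \<le> (\<integral>\<^sup>+x. ennreal ((f x - c)\<^sup>2) \<partial>M)"
proof (cases "(\<integral>\<^sup>+x. ennreal ((f x - c)\<^sup>2) \<partial>M) < \<infinity>")
  case True
  interpret finite_measure M by fact
  have int2: "integrable M (\<lambda>x. (f x - c)\<^sup>2)"
    using True by (intro integrableI_nonneg) auto
  then have "integrable M (\<lambda>x. f x - c)"
    by (rule square_integrable_imp_integrable[rotated]) auto
  from Bochner_Integration.integrable_add[OF this integrable_const[of c]]
  have int: "integrable M f" by simp
  have conv: "convex_on UNIV (\<lambda>y::real. (y - c)\<^sup>2)"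
    by (rule f''_ge0_imp_convex[where f'="\<lambda>y. 2 * (y - c)" and f''="\<lambda>_. 2"])
       (auto intro!: derivative_eq_intros)
  \<comment> \<open>The interval is the whole line, so its endpoints \<open>a\<close> and
    \<open>b\<close> get arbitrary values.\<close>
  have "AE x in M. (real_cond_exp M F f x - c)\<^sup>2 \<le> real_cond_exp M F (\<lambda>x. (f x - c)\<^sup>2) x"
    by (rule real_cond_exp_jensens_inequality(2)[where I=UNIV and q="\<lambda>y. (y - c)\<^sup>2" and a=0 and b=0, OF int])
       (use int2 conv in auto)
  then have "(\<integral>\<^sup>+x. ennreal ((real_cond_exp M F f x - c)\<^sup>2) \<partial>M)
      \<le> (\<integral>\<^sup>+x. ennreal (real_cond_exp M F (\<lambda>x. (f x - c)\<^sup>2) x) \<partial>M)"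
    by (intro nn_integral_mono_AE) (auto elim!: eventually_mono intro: ennreal_leI)
  also have "\<dots> = ennreal (\<integral>x. real_cond_exp M F (\<lambda>x. (f x - c)\<^sup>2) x \<partial>M)"
    by (intro nn_integral_eq_integral real_cond_exp_int int2 real_cond_exp_pos) auto
  also have "\<dots> = ennreal (\<integral>x. (f x - c)\<^sup>2 \<partial>M)"
    by (simp add: real_cond_exp_int(2)[OF int2])
  also have "\<dots> = (\<integral>\<^sup>+x. ennreal ((f x - c)\<^sup>2) \<partial>M)"
    by (intro nn_integral_eq_integral[symmetric] int2) auto
  finally show ?thesis .
qed (simp add: not_less top_unique)

end

text \<open>With the coordinate projections as observations, \<open>Shat\<close> becomes a function
  of the family \<open>x\<close> itself and can be composed with \<open>rot45\<close>. Only the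
  terms \<open>i\<close> and \<open>j\<close> change, and in their sum the cross terms
  cancel.\<close>

lemma Shat_rot45:
  fixes x :: "nat \<Rightarrow> real^'p"
  assumes "i < n" "j < n" "i \<noteq> j"
  shows "Shat n (\<lambda>k x. x k) (rot45 i j x) = Shat n (\<lambda>k x. x k) x"
proof -
  define R where "R = {..<n} - {i, j}"
  have R: "{..<n} = insert i (insert j R)" "i \<notin> insert j R" "j \<notin> R" "finite R"
    using assms by (auto simp: R_def)
  have "(\<Sum>k\<in>R. outer (rot45 i j x k) (rot45 i j x k)) = (\<Sum>k\<in>R. outer (x k) (x k))"
    using R by (intro sum.cong) (auto simp: rot45_def)
  moreover have "outer (rot45 i j x i) (rot45 i j x i) + outer (rot45 i j x j) (rot45 i j x j)
      = outer (x i) (x i) + outer (x j) (x j)"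
    using \<open>i \<noteq> j\<close> outer_rot45[of "x i" "x j"] by (simp add: rot45_def)
  ultimately show ?thesis
    unfolding Shat_def R(1) using R(2-4) by (simp add: add.assoc[symmetric])
qed

text \<open>The left side is going to be the conditional mean of the sum of fourth powers given S;
  as a double sum it can be matched with the pairwise identities coming from the rotation.\<close>

lemma trace_poly_eq_sum:
  assumes "n > 0"
  shows "(real n)\<^sup>2 / (n + 2) * ((mtrace (Shat n X \<omega>))\<^sup>2 + 2 * mtrace (Shat n X \<omega> ** Shat n X \<omega>))
    = (\<Sum>i<n. \<Sum>j<n. (norm (X i \<omega>))\<^sup>2 * (norm (X j \<omega>))\<^sup>2 + 2 * (X i \<omega> \<bullet> X j \<omega>)\<^sup>2) / (n + 2)"
proof -
  have "(\<Sum>i<n. \<Sum>j<n. (norm (X i \<omega>))\<^sup>2 * (norm (X j \<omega>))\<^sup>2) = (\<Sum>i<n. (norm (X i \<omega>))\<^sup>2)\<^sup>2"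
    by (simp add: power2_eq_square sum_product)
  then show ?thesis
    using assms unfolding mtrace_Shat mtrace_Shat_sq
    by (simp add: sum.distrib sum_distrib_left[symmetric] power_divide distrib_left add_divide_distrib)
qed

subsection \<open>Samples with rotation-invariant law\<close>

text \<open>Isolates the property through which independence and normality act. The restriction to
  \<open>{..<n}\<close> makes the sample a point of the product space.\<close>

locale rot45_invariant_sample = prob_space M for M :: "'a measure" +
  fixes X :: "nat \<Rightarrow> 'a \<Rightarrow> real^'p" and n :: nat
  assumes borel_measurable_sample: "i < n \<Longrightarrow> X i \<in> borel_measurable M"
    and distr_rot45: "i < n \<Longrightarrow> j < n \<Longrightarrow> i \<noteq> j \<Longrightarrow>
      distr M (PiM {..<n} (\<lambda>_. borel)) (\<lambda>\<omega>. rot45 i j (\<lambda>k\<in>{..<n}. X k \<omega>))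
      = distr M (PiM {..<n} (\<lambda>_. borel)) (\<lambda>\<omega>. \<lambda>k\<in>{..<n}. X k \<omega>)"
begin

lemma measurable_restrict_sample [measurable]:
  "(\<lambda>\<omega>. \<lambda>k\<in>{..<n}. X k \<omega>) \<in> measurable M (PiM {..<n} (\<lambda>_. borel))"
  by (intro measurable_restrict) (auto intro: borel_measurable_sample)

lemma borel_measurable_Shat_sample [measurable]: "Shat n X \<in> borel_measurable M"
  by (rule borel_measurable_Shat) (rule borel_measurable_sample)

lemma Shat_restrict: "Shat n (\<lambda>k x. x k) (\<lambda>k\<in>{..<n}. X k \<omega>) = Shat n X \<omega>"
  by (simp add: Shat_def)

text \<open>\<open>w\<close> of S is unchanged by the rotation, so passing to the rotated sample,
  which has the same law, alters only the fourth powers. Transfer along a law holds for every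
  measurable integrand, so integrability plays no part yet.\<close>

lemma integral_norm4_rot45:
  assumes [measurable]: "w \<in> borel_measurable borel" and ij: "i < n" "j < n" "i \<noteq> j"
  shows "(\<integral>\<omega>. w (Shat n X \<omega>) * (norm (X i \<omega>) ^ 4 + norm (X j \<omega>) ^ 4) \<partial>M)
    = (\<integral>\<omega>. w (Shat n X \<omega>) * ((norm (X i \<omega>) ^ 4 + norm (X j \<omega>) ^ 4
          + 2 * (norm (X i \<omega>))\<^sup>2 * (norm (X j \<omega>))\<^sup>2 + 4 * (X i \<omega> \<bullet> X j \<omega>)\<^sup>2) / 2) \<partial>M)"
proof -
  let ?I = "PiM {..<n} (\<lambda>_. borel :: (real^'p) measure)"
  let ?x = "\<lambda>\<omega>. \<lambda>k\<in>{..<n}. X k \<omega>"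
  let ?h = "\<lambda>x. w (Shat n (\<lambda>k x. x k) x) * (norm (x i) ^ 4 + norm (x j) ^ 4)"
  have [measurable]: "Shat n (\<lambda>k x. x k) \<in> borel_measurable ?I"
    by (rule borel_measurable_Shat) simp
  have [measurable]: "(\<lambda>x. x i) \<in> borel_measurable ?I" "(\<lambda>x. x j) \<in> borel_measurable ?I"
    using ij by auto
  have [measurable]: "rot45 i j \<in> measurable ?I ?I"
    using ij by (intro measurable_rot45) auto
  have h: "?h \<in> borel_measurable ?I" by measurable
  have "(\<integral>\<omega>. ?h (?x \<omega>) \<partial>M) = (\<integral>x. ?h x \<partial>distr M ?I ?x)"
    by (rule integral_distr[symmetric, OF _ h]) measurable
  also have "\<dots> = (\<integral>x. ?h x \<partial>distr M ?I (\<lambda>\<omega>. rot45 i j (?x \<omega>)))"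
    by (simp only: distr_rot45[OF ij])
  also have "\<dots> = (\<integral>\<omega>. ?h (rot45 i j (?x \<omega>)) \<partial>M)"
    by (rule integral_distr[OF _ h]) measurable
  finally have "(\<integral>\<omega>. ?h (?x \<omega>) \<partial>M) = (\<integral>\<omega>. ?h (rot45 i j (?x \<omega>)) \<partial>M)" .
  moreover have "norm (rot45 i j (?x \<omega>) i) ^ 4 + norm (rot45 i j (?x \<omega>) j) ^ 4
      = (norm (X i \<omega>) ^ 4 + norm (X j \<omega>) ^ 4
          + 2 * (norm (X i \<omega>))\<^sup>2 * (norm (X j \<omega>))\<^sup>2 + 4 * (X i \<omega> \<bullet> X j \<omega>)\<^sup>2) / 2" for \<omega>
    using ij norm4_rot45[of "X i \<omega>" "X j \<omega>"] by (simp only: rot45_def) simp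
  ultimately show ?thesis
    unfolding Shat_rot45[OF ij] Shat_restrict using ij by simp
qed

section \<open>Integration against bounded weights that vanish where the trace of S is large\<close>

context
  fixes w :: "real^'p^'p \<Rightarrow> real" and C K :: real
  assumes w [measurable]: "w \<in> borel_measurable borel"
    and w_bound: "\<And>S. \<bar>w S\<bar> \<le> C"
    and w_support: "\<And>S. w S \<noteq> 0 \<Longrightarrow> mtrace S \<le> K"
begin

text \<open>The squared norms add up to n Tr(S), so each is at most n K where the weight is nonzero.
  The integrand is therefore bounded, which replaces any moment estimate.\<close>

lemma integrable_weighted_norm_sq_mult:
  assumes ij: "i < n" "j < n"
  shows "integrable M (\<lambda>\<omega>. w (Shat n X \<omega>) * ((norm (X i \<omega>))\<^sup>2 * (norm (X j \<omega>))\<^sup>2))"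
proof (rule integrable_const_bound[where B="C * (n * K)\<^sup>2"])
  note [measurable] = borel_measurable_sample[OF ij(1)] borel_measurable_sample[OF ij(2)]
  show "(\<lambda>\<omega>. w (Shat n X \<omega>) * ((norm (X i \<omega>))\<^sup>2 * (norm (X j \<omega>))\<^sup>2)) \<in> borel_measurable M"
    by measurable
  have "norm (w (Shat n X \<omega>) * ((norm (X i \<omega>))\<^sup>2 * (norm (X j \<omega>))\<^sup>2)) \<le> C * (n * K)\<^sup>2" for \<omega>
  proof (cases "w (Shat n X \<omega>) = 0")
    case False
    have le: "(norm (X k \<omega>))\<^sup>2 \<le> n * K" if "k < n" for k
    proof -
      have "(norm (X k \<omega>))\<^sup>2 \<le> (\<Sum>k<n. (norm (X k \<omega>))\<^sup>2)"
        using that by (intro member_le_sum) auto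
      also have "\<dots> = n * mtrace (Shat n X \<omega>)"
        using that by (simp add: mtrace_Shat)
      also have "\<dots> \<le> n * K"
        using w_support[OF False] by (intro mult_left_mono) auto
      finally show ?thesis .
    qed
    have "0 \<le> n * K" using le[OF ij(1)] by (rule order_trans[rotated]) simp
    then have "(norm (X i \<omega>))\<^sup>2 * (norm (X j \<omega>))\<^sup>2 \<le> (n * K) * (n * K)"
      using le[OF ij(1)] le[OF ij(2)] by (intro mult_mono) auto
    then have "\<bar>w (Shat n X \<omega>)\<bar> * ((norm (X i \<omega>))\<^sup>2 * (norm (X j \<omega>))\<^sup>2) \<le> C * ((n * K) * (n * K))"
      using order_trans[OF abs_ge_zero w_bound] by (intro mult_mono[OF w_bound]) auto
    then show ?thesis by (simp add: abs_mult power2_eq_square)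
  next
    case True
    have "0 \<le> C" using w_bound[of 0] by linarith
    with True show ?thesis by simp
  qed
  then show "AE \<omega> in M. norm (w (Shat n X \<omega>) * ((norm (X i \<omega>))\<^sup>2 * (norm (X j \<omega>))\<^sup>2)) \<le> C * (n * K)\<^sup>2"
    by simp
qed

lemma integrable_weighted_norm4:
  "i < n \<Longrightarrow> integrable M (\<lambda>\<omega>. w (Shat n X \<omega>) * norm (X i \<omega>) ^ 4)"
  using integrable_weighted_norm_sq_mult[of i i] by (simp add: power_add[symmetric])

lemma integrable_weighted_inner_sq:
  assumes ij: "i < n" "j < n"
  shows "integrable M (\<lambda>\<omega>. w (Shat n X \<omega>) * (X i \<omega> \<bullet> X j \<omega>)\<^sup>2)"
proof (rule Bochner_Integration.integrable_bound[OF integrable_weighted_norm_sq_mult[OF ij]])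
  note [measurable] = borel_measurable_sample[OF ij(1)] borel_measurable_sample[OF ij(2)]
  show "(\<lambda>\<omega>. w (Shat n X \<omega>) * (X i \<omega> \<bullet> X j \<omega>)\<^sup>2) \<in> borel_measurable M"
    by measurable
  have "(x \<bullet> y)\<^sup>2 \<le> (norm x)\<^sup>2 * (norm y)\<^sup>2" for x y :: "real^'p"
    using Cauchy_Schwarz_ineq[of x y] by (simp add: power2_norm_eq_inner)
  then show "AE \<omega> in M. norm (w (Shat n X \<omega>) * (X i \<omega> \<bullet> X j \<omega>)\<^sup>2)
      \<le> norm (w (Shat n X \<omega>) * ((norm (X i \<omega>))\<^sup>2 * (norm (X j \<omega>))\<^sup>2))"
    by (simp add: abs_mult mult_left_mono)
qed

lemma integrable_weighted_trace_poly:
  assumes "n > 0"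
  shows "integrable M (\<lambda>\<omega>. w (Shat n X \<omega>) * ((real n)\<^sup>2 / (n + 2)
    * ((mtrace (Shat n X \<omega>))\<^sup>2 + 2 * mtrace (Shat n X \<omega> ** Shat n X \<omega>))))"
proof -
  have "integrable M (\<lambda>\<omega>. (\<Sum>i<n. \<Sum>j<n. w (Shat n X \<omega>) * ((norm (X i \<omega>))\<^sup>2 * (norm (X j \<omega>))\<^sup>2)
      + 2 * (w (Shat n X \<omega>) * (X i \<omega> \<bullet> X j \<omega>)\<^sup>2)) / (n + 2))"
    using integrable_weighted_norm_sq_mult integrable_weighted_inner_sq
    by (intro integrable_divide Bochner_Integration.integrable_sum
      Bochner_Integration.integrable_add integrable_mult_right) auto
  then show ?thesis
    unfolding trace_poly_eq_sum[OF assms] by (simp add: sum_distrib_left algebra_simps)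
qed

lemma integrable_weighted_sum_norm4:
  "integrable M (\<lambda>\<omega>. w (Shat n X \<omega>) * (\<Sum>i<n. norm (X i \<omega>) ^ 4))"
  unfolding sum_distrib_left using integrable_weighted_norm4
  by (intro Bochner_Integration.integrable_sum) auto

text \<open>This is the defining equation of the conditional mean given S, with \<open>w\<close> as
  test function. It comes from adding the rotation identity over all pairs and treating the diagonal
  separately.\<close>

lemma integral_weighted_sum_norm4:
  assumes "n > 0"
  shows "(\<integral>\<omega>. w (Shat n X \<omega>) * (\<Sum>i<n. norm (X i \<omega>) ^ 4) \<partial>M)
   = (\<integral>\<omega>. w (Shat n X \<omega>) * ((real n)\<^sup>2 / (n + 2)
        * ((mtrace (Shat n X \<omega>))\<^sup>2 + 2 * mtrace (Shat n X \<omega> ** Shat n X \<omega>))) \<partial>M)"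
proof -
  define e where "e i = (\<integral>\<omega>. w (Shat n X \<omega>) * norm (X i \<omega>) ^ 4 \<partial>M)" for i
  define a where "a i j = (\<integral>\<omega>. w (Shat n X \<omega>) * ((norm (X i \<omega>))\<^sup>2 * (norm (X j \<omega>))\<^sup>2) \<partial>M)" for i j
  define b where "b i j = (\<integral>\<omega>. w (Shat n X \<omega>) * (X i \<omega> \<bullet> X j \<omega>)\<^sup>2 \<partial>M)" for i j
  note int = integrable_weighted_norm4 integrable_weighted_norm_sq_mult integrable_weighted_inner_sq
  have off_diag: "a i j + 2 * b i j = (e i + e j) / 2" if ij: "i < n" "j < n" "i \<noteq> j" for i j
  proof -
    have "e i + e j = (\<integral>\<omega>. w (Shat n X \<omega>) * (norm (X i \<omega>) ^ 4 + norm (X j \<omega>) ^ 4) \<partial>M)"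
      unfolding e_def distrib_left
      by (rule Bochner_Integration.integral_add[symmetric]) (use ij int in auto)
    \<comment> \<open>The rotated integrand returns half of the fourth powers; moving that half to
      the left leaves the identity for \<open>a\<close> and \<open>b\<close>.\<close>
    also have "\<dots> = (\<integral>\<omega>. (w (Shat n X \<omega>) * norm (X i \<omega>) ^ 4 + w (Shat n X \<omega>) * norm (X j \<omega>) ^ 4) / 2
          + w (Shat n X \<omega>) * ((norm (X i \<omega>))\<^sup>2 * (norm (X j \<omega>))\<^sup>2)
          + 2 * (w (Shat n X \<omega>) * (X i \<omega> \<bullet> X j \<omega>)\<^sup>2) \<partial>M)"
      unfolding integral_norm4_rot45[OF w ij]
      by (intro Bochner_Integration.integral_cong refl) (simp add: field_simps)
    also have "\<dots> = (e i + e j) / 2 + a i j + 2 * b i j"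
      unfolding e_def a_def b_def using ij int by simp
    finally show ?thesis by argo
  qed
  have diag: "a i i = e i" "b i i = e i" for i
    unfolding a_def b_def e_def
    by (simp_all add: power_add[symmetric] power2_norm_eq_inner[symmetric])
  \<comment> \<open>On the diagonal the summand is 3 e i, which exceeds the off-diagonal formula by
    2 e i. The formula over all pairs gives n times the sum of the e i and the excess gives twice
    that sum, hence the factor n + 2.\<close>
  have "(\<Sum>i<n. \<Sum>j<n. a i j + 2 * b i j) = (\<Sum>i<n. \<Sum>j<n. (e i + e j) / 2 + (if i = j then 2 * e i else 0))"
    by (intro sum.cong refl) (auto simp: off_diag diag)
  also have "\<dots> = (n + 2) * (\<Sum>i<n. e i)"
    by (simp add: sum.distrib sum_divide_distrib[symmetric] sum_distrib_left[symmetric] distrib_right)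
  finally have sum_eq: "(\<Sum>i<n. \<Sum>j<n. a i j + 2 * b i j) = (n + 2) * (\<Sum>i<n. e i)" .
  have "(\<integral>\<omega>. w (Shat n X \<omega>) * (\<Sum>i<n. norm (X i \<omega>) ^ 4) \<partial>M) = (\<Sum>i<n. e i)"
    unfolding sum_distrib_left e_def by (rule Bochner_Integration.integral_sum) (use int in auto)
  also have "\<dots> = (\<Sum>i<n. \<Sum>j<n. a i j + 2 * b i j) / (n + 2)"
    unfolding sum_eq by simp
  also have "\<dots> = (\<integral>\<omega>. (\<Sum>i<n. \<Sum>j<n. w (Shat n X \<omega>) * ((norm (X i \<omega>))\<^sup>2 * (norm (X j \<omega>))\<^sup>2)
      + 2 * (w (Shat n X \<omega>) * (X i \<omega> \<bullet> X j \<omega>)\<^sup>2)) / (n + 2) \<partial>M)"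
  proof -
    let ?g = "\<lambda>i j \<omega>. w (Shat n X \<omega>) * ((norm (X i \<omega>))\<^sup>2 * (norm (X j \<omega>))\<^sup>2)
      + 2 * (w (Shat n X \<omega>) * (X i \<omega> \<bullet> X j \<omega>)\<^sup>2)"
    have g: "integrable M (?g i j)" "(\<integral>\<omega>. ?g i j \<omega> \<partial>M) = a i j + 2 * b i j" if "i < n" "j < n" for i j
      using that int unfolding a_def b_def by auto
    have "(\<integral>\<omega>. (\<Sum>i<n. \<Sum>j<n. ?g i j \<omega>) \<partial>M) = (\<Sum>i<n. \<integral>\<omega>. (\<Sum>j<n. ?g i j \<omega>) \<partial>M)"
      using g(1) by (intro Bochner_Integration.integral_sum Bochner_Integration.integrable_sum) auto
    also have "\<dots> = (\<Sum>i<n. \<Sum>j<n. \<integral>\<omega>. ?g i j \<omega> \<partial>M)"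
      using g(1) by (intro sum.cong refl Bochner_Integration.integral_sum) auto
    also have "\<dots> = (\<Sum>i<n. \<Sum>j<n. a i j + 2 * b i j)"
      using g(2) by (intro sum.cong refl) auto
    finally show ?thesis by simp
  qed
  also have "\<dots> = (\<integral>\<omega>. w (Shat n X \<omega>) * ((real n)\<^sup>2 / (n + 2)
        * ((mtrace (Shat n X \<omega>))\<^sup>2 + 2 * mtrace (Shat n X \<omega> ** Shat n X \<omega>))) \<partial>M)"
    unfolding trace_poly_eq_sum[OF assms] by (simp add: sum_distrib_left algebra_simps)
  finally show ?thesis .
qed

end

end

section \<open>Conditional expectation given the sample covariance\<close>

context rot45_invariant_sample
begin

abbreviation "F_Shat \<equiv> vimage_algebra (space M) (Shat n X) borel"

lemma subalgebra_Shat: "subalgebra M F_Shat"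
  unfolding subalgebra_def by (simp add: sets_image_in_sets)

lemma measurable_Shat_F_Shat [measurable]: "Shat n X \<in> borel_measurable F_Shat"
  by (rule measurable_vimage_algebra1) simp

text \<open>\<open>a\<close> and \<open>b\<close> are arbitrary Borel functions, so the integrand
  may fail to be integrable. The local characterization is therefore applied on the sets
  \<open>D k\<close> where \<open>a\<close>, \<open>b\<close> and the trace are bounded; these
  exhaust all matrices.\<close>

lemma real_cond_exp_affine_norm4:
  assumes [measurable]: "a \<in> borel_measurable borel" "b \<in> borel_measurable borel" and n: "n > 0"
  shows "AE \<omega> in M. real_cond_exp M F_Shat
      (\<lambda>\<omega>. a (Shat n X \<omega>) + b (Shat n X \<omega>) * (\<Sum>i<n. norm (X i \<omega>) ^ 4)) \<omega>
    = a (Shat n X \<omega>) + b (Shat n X \<omega>) * ((real n)\<^sup>2 / (n + 2)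
        * ((mtrace (Shat n X \<omega>))\<^sup>2 + 2 * mtrace (Shat n X \<omega> ** Shat n X \<omega>)))"
proof -
  interpret finite_measure_subalgebra M F_Shat
    by standard (rule subalgebra_Shat)
  let ?T = "\<lambda>\<omega>. \<Sum>i<n. norm (X i \<omega>) ^ 4"
  let ?\<phi> = "\<lambda>\<omega>. (real n)\<^sup>2 / (n + 2) * ((mtrace (Shat n X \<omega>))\<^sup>2
      + 2 * mtrace (Shat n X \<omega> ** Shat n X \<omega>))"
  let ?S = "Shat n X"
  let ?Y = "\<lambda>t \<omega>. a (Shat n X \<omega>) + b (Shat n X \<omega>) * t \<omega>"
  define D where "D k = {S. \<bar>a S\<bar> \<le> real k \<and> \<bar>b S\<bar> \<le> real k \<and> mtrace S \<le> real k}" for k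
  let ?B = "\<lambda>E k. Shat n X -` (E \<inter> D k) \<inter> space M"
  have D [measurable]: "D k \<in> sets borel" for k
    unfolding D_def by measurable
  have T [measurable]: "?T \<in> borel_measurable M"
    using borel_measurable_sample by (intro borel_measurable_sum borel_measurable_power borel_measurable_norm) auto
  have int_a: "integrable M (\<lambda>\<omega>. indicator (E \<inter> D k) (?S \<omega>) * a (?S \<omega>))"
    if [measurable]: "E \<in> sets borel" for E k
  proof (rule integrable_const_bound[where B="real k"])
    show "AE \<omega> in M. norm (indicator (E \<inter> D k) (?S \<omega>) * a (?S \<omega>)) \<le> real k"
      by (auto simp: D_def indicator_def)
  qed measurable
  \<comment> \<open>Cut off on \<open>E \<inter> D k\<close>, the coefficient \<open>b\<close> is an
    admissible weight with \<open>C\<close> and \<open>K\<close> both equal to \<open>k\<close>;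
    \<open>E\<close> ranges over the test sets for S.\<close>
  have weight: "(\<lambda>S. indicator (E \<inter> D k) S * b S) \<in> borel_measurable borel"
    "\<And>S. \<bar>indicator (E \<inter> D k) S * b S\<bar> \<le> real k"
    "\<And>S. indicator (E \<inter> D k) S * b S \<noteq> 0 \<Longrightarrow> mtrace S \<le> real k"
    if [measurable]: "E \<in> sets borel" for E k
    by (measurable, auto simp: D_def indicator_def)
  have int_T: "integrable M (\<lambda>\<omega>. indicator (E \<inter> D k) (?S \<omega>) * b (?S \<omega>) * ?T \<omega>)"
    if "E \<in> sets borel" for E k
    by (rule integrable_weighted_sum_norm4[where w="\<lambda>S. indicator (E \<inter> D k) S * b S" and C="real k" and K="real k"])
       (fact weight[OF that] n)+
  have int_\<phi>: "integrable M (\<lambda>\<omega>. indicator (E \<inter> D k) (?S \<omega>) * b (?S \<omega>) * ?\<phi> \<omega>)"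
    if "E \<in> sets borel" for E k
    by (rule integrable_weighted_trace_poly[where w="\<lambda>S. indicator (E \<inter> D k) S * b S" and C="real k" and K="real k"])
       (fact weight[OF that] n)+
  have eq_T: "(\<integral>\<omega>. indicator (E \<inter> D k) (?S \<omega>) * b (?S \<omega>) * ?T \<omega> \<partial>M)
      = (\<integral>\<omega>. indicator (E \<inter> D k) (?S \<omega>) * b (?S \<omega>) * ?\<phi> \<omega> \<partial>M)"
    if "E \<in> sets borel" for E k
    by (rule integral_weighted_sum_norm4[where w="\<lambda>S. indicator (E \<inter> D k) S * b S" and C="real k" and K="real k"])
       (fact weight[OF that] n)+
  have ind: "indicator (?S -` E \<inter> space M) \<omega> = (indicator E (?S \<omega>) :: real)" if "\<omega> \<in> space M" for E \<omega>
    using that by (auto simp: indicator_def)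
  \<comment> \<open>\<open>t\<close> stands both for the sum of fourth powers and for its candidate
    conditional mean; \<open>eq_T\<close> equates the two resulting integrals.\<close>
  have split: "integrable M (\<lambda>\<omega>. indicator (?B E k) \<omega> * ?Y t \<omega>)"
    "(\<integral>\<omega>. indicator (?B E k) \<omega> * ?Y t \<omega> \<partial>M)
      = (\<integral>\<omega>. indicator (E \<inter> D k) (?S \<omega>) * a (?S \<omega>) \<partial>M)
        + (\<integral>\<omega>. indicator (E \<inter> D k) (?S \<omega>) * b (?S \<omega>) * t \<omega> \<partial>M)"
    if E: "E \<in> sets borel" and t: "integrable M (\<lambda>\<omega>. indicator (E \<inter> D k) (?S \<omega>) * b (?S \<omega>) * t \<omega>)" for E k t
  proof -
    have eq: "indicator (?B E k) \<omega> * ?Y t \<omega>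
      = indicator (E \<inter> D k) (?S \<omega>) * a (?S \<omega>) + indicator (E \<inter> D k) (?S \<omega>) * b (?S \<omega>) * t \<omega>"
      if "\<omega> \<in> space M" for \<omega>
      using that by (simp only: ind distrib_left mult.assoc)
    show "integrable M (\<lambda>\<omega>. indicator (?B E k) \<omega> * ?Y t \<omega>)"
      using Bochner_Integration.integrable_add[OF int_a[OF E] t]
      by (subst Bochner_Integration.integrable_cong[OF refl eq])
    have "(\<integral>\<omega>. indicator (?B E k) \<omega> * ?Y t \<omega> \<partial>M)
        = (\<integral>\<omega>. indicator (E \<inter> D k) (?S \<omega>) * a (?S \<omega>) + indicator (E \<inter> D k) (?S \<omega>) * b (?S \<omega>) * t \<omega> \<partial>M)"
      by (rule Bochner_Integration.integral_cong[OF refl eq])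
    also have "\<dots> = (\<integral>\<omega>. indicator (E \<inter> D k) (?S \<omega>) * a (?S \<omega>) \<partial>M)
        + (\<integral>\<omega>. indicator (E \<inter> D k) (?S \<omega>) * b (?S \<omega>) * t \<omega> \<partial>M)"
      by (rule Bochner_Integration.integral_add[OF int_a[OF E] t])
    finally show "(\<integral>\<omega>. indicator (?B E k) \<omega> * ?Y t \<omega> \<partial>M)
      = (\<integral>\<omega>. indicator (E \<inter> D k) (?S \<omega>) * a (?S \<omega>) \<partial>M)
        + (\<integral>\<omega>. indicator (E \<inter> D k) (?S \<omega>) * b (?S \<omega>) * t \<omega> \<partial>M)" .
  qed
  show ?thesis
  proof (rule real_cond_exp_charact_local[where A="\<lambda>k. ?S -` D k \<inter> space M"])
    show "(\<lambda>\<omega>. ?Y ?T \<omega>) \<in> borel_measurable M"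
      by measurable
    show "(\<lambda>\<omega>. ?Y ?\<phi> \<omega>) \<in> borel_measurable F_Shat"
      by measurable
    show "?S -` D k \<inter> space M \<in> sets F_Shat" for k
      by (rule in_vimage_algebra) measurable
    have "\<exists>k. S \<in> D k" for S
    proof -
      obtain k :: nat where "max (max \<bar>a S\<bar> \<bar>b S\<bar>) (mtrace S) \<le> k"
        using real_arch_simple by blast
      then show ?thesis by (auto simp: D_def)
    qed
    then show "(\<Union>k. ?S -` D k \<inter> space M) = space M" by auto
    show "integrable M (\<lambda>\<omega>. indicator (?S -` D k \<inter> space M) \<omega> * ?Y ?T \<omega>)"
      "integrable M (\<lambda>\<omega>. indicator (?S -` D k \<inter> space M) \<omega> * ?Y ?\<phi> \<omega>)" for k
      using split(1)[OF _ int_T, of UNIV k] split(1)[OF _ int_\<phi>, of UNIV k] by simp_all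
    fix k B assume "B \<in> sets F_Shat" and sub: "B \<subseteq> ?S -` D k \<inter> space M"
    then obtain E where E: "E \<in> sets borel" "B = ?S -` E \<inter> space M"
      by (auto simp: sets_vimage_algebra2)
    with sub have "B = ?B E k" by auto
    with split(2)[OF E(1) int_T[OF E(1)], of k] split(2)[OF E(1) int_\<phi>[OF E(1)], of k] eq_T[OF E(1), of k]
    show "(\<integral>\<omega>. indicator B \<omega> * ?Y ?T \<omega> \<partial>M)
      = (\<integral>\<omega>. indicator B \<omega> * ?Y ?\<phi> \<omega> \<partial>M)" by simp
  qed
qed

end

subsection \<open>The Ledoit--Wolf estimator and its Rao--Blackwellization\<close>

text \<open>The coefficient of the sum of fourth powers in entry (i, j) of the Ledoit-Wolf
  estimator. If the denominator vanishes, division by zero makes it 0, just as it makes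
  \<open>rho_LW\<close> and \<open>rho_RBLW\<close> 0, so the affine formulas below hold at every
  sample point.\<close>

definition LW_slope :: "nat \<Rightarrow> 'p \<Rightarrow> 'p \<Rightarrow> real^'p^'p \<Rightarrow> real" where
  "LW_slope n i j S = (Fhat S $ i $ j - S $ i $ j)
     / ((real n)\<^sup>2 * (mtrace (S ** S) - (mtrace S)\<^sup>2 / real CARD('p)))"

definition LW_offset :: "nat \<Rightarrow> 'p \<Rightarrow> 'p \<Rightarrow> real^'p^'p \<Rightarrow> real" where
  "LW_offset n i j S = S $ i $ j - LW_slope n i j S * (n * mtrace (S ** S))"

lemma borel_measurable_LW_slope [measurable]: "LW_slope n i j \<in> borel_measurable borel"
  unfolding LW_slope_def[abs_def] Fhat_def by simp

lemma borel_measurable_LW_offset [measurable]: "LW_offset n i j \<in> borel_measurable borel"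
  unfolding LW_offset_def[abs_def] by measurable

text \<open>The numerator of \<open>rho_LW\<close> is the sum of fourth powers minus n Tr(S^2); the
  subtracted term goes into \<open>LW_offset\<close>.\<close>

lemma Sigma_LW_affine:
  "Sigma_LW n X \<omega> $ i $ j = LW_offset n i j (Shat n X \<omega>)
     + LW_slope n i j (Shat n X \<omega>) * (\<Sum>k<n. norm (X k \<omega>) ^ 4)"
proof -
  have "(1 - u / d) * s + u / d * f = s - (f - s) / d * m + (f - s) / d * t"
    if "u = t - m" for u d s f m t :: real
    unfolding that by (simp add: algebra_simps add_divide_distrib diff_divide_distrib)
  from this[OF sum_frob_outer_diff_Shat] show ?thesis
    by (simp add: Sigma_LW_def rho_LW_def Let_def LW_offset_def LW_slope_def)
qed

text \<open>Putting the conditional mean in place of the sum of fourth powers turns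
  \<open>rho_LW\<close> into \<open>rho_RBLW\<close>: the coefficient of Tr(S^2) becomes 2 / (n + 2)
  - 1 / n = (n - 2) / (n (n + 2)), and that of Tr(S)^2 becomes 1 / (n + 2).\<close>

lemma Sigma_RBLW_affine:
  assumes "n > 0"
  shows "Sigma_RBLW n X \<omega> $ i $ j = LW_offset n i j (Shat n X \<omega>)
     + LW_slope n i j (Shat n X \<omega>) * ((real n)\<^sup>2 / (n + 2)
        * ((mtrace (Shat n X \<omega>))\<^sup>2 + 2 * mtrace (Shat n X \<omega> ** Shat n X \<omega>)))"
proof -
  have num: "((x - 2) / x * q + t\<^sup>2) / (x + 2)
     = (x\<^sup>2 / (x + 2) * (t\<^sup>2 + 2 * q) - x * q) / x\<^sup>2" if "x > 0" for q t x :: real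
  proof -
    have "x \<noteq> 0" "x + 2 \<noteq> 0" using that by auto
    then show ?thesis by (simp add: divide_simps) algebra
  qed
  have rho: "rho_RBLW n S = ((real n)\<^sup>2 / (n + 2) * ((mtrace S)\<^sup>2 + 2 * mtrace (S ** S)) - n * mtrace (S ** S))
      / ((real n)\<^sup>2 * (mtrace (S ** S) - (mtrace S)\<^sup>2 / real CARD('a)))" for S :: "real^'a^'a"
    using num[of "real n" "mtrace (S ** S)" "mtrace S"] assms
    unfolding rho_RBLW_def divide_divide_eq_left[symmetric] by simp
  have "(1 - u / d) * s + u / d * f = s - (f - s) / d * m + (f - s) / d * t"
    if "u = t - m" for u d s f m t :: real
    unfolding that by (simp add: algebra_simps add_divide_distrib diff_divide_distrib)
  from this[OF refl] show ?thesis
    by (simp add: Sigma_RBLW_def rho Let_def LW_offset_def LW_slope_def)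
qed

context rot45_invariant_sample
begin

lemma real_cond_exp_Sigma_LW:
  assumes "n > 0"
  shows "AE \<omega> in M. real_cond_exp M F_Shat (\<lambda>\<eta>. Sigma_LW n X \<eta> $ i $ j) \<omega> = Sigma_RBLW n X \<omega> $ i $ j"
  unfolding Sigma_LW_affine Sigma_RBLW_affine[OF assms]
  by (intro real_cond_exp_affine_norm4 assms) measurable

lemma borel_measurable_Sigma_LW [measurable]: "(\<lambda>\<omega>. Sigma_LW n X \<omega> $ i $ j) \<in> borel_measurable M"
proof -
  have [measurable]: "(\<lambda>\<omega>. \<Sum>k<n. norm (X k \<omega>) ^ 4) \<in> borel_measurable M"
    using borel_measurable_sample by (intro borel_measurable_sum borel_measurable_power borel_measurable_norm) auto
  show ?thesis unfolding Sigma_LW_affine by measurable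
qed

text \<open>The Frobenius risk is the sum of the scalar risks of the entries, and conditioning does
  not increase any of these.\<close>

lemma risk_Sigma_RBLW_le:
  assumes "n > 0"
  shows "(\<integral>\<^sup>+\<omega>. ennreal ((frob (Sigma_RBLW n X \<omega> - A))\<^sup>2) \<partial>M)
    \<le> (\<integral>\<^sup>+\<omega>. ennreal ((frob (Sigma_LW n X \<omega> - A))\<^sup>2) \<partial>M)"
proof -
  interpret finite_measure_subalgebra M F_Shat
    by standard (rule subalgebra_Shat)
  have [measurable]: "(\<lambda>\<omega>. Sigma_RBLW n X \<omega> $ i $ j) \<in> borel_measurable M" for i j
    unfolding Sigma_RBLW_affine[OF assms] by measurable
  have frob: "(\<integral>\<^sup>+\<omega>. ennreal ((frob (Y \<omega> - A))\<^sup>2) \<partial>M)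
      = (\<Sum>i\<in>UNIV. \<Sum>j\<in>UNIV. \<integral>\<^sup>+\<omega>. ennreal ((Y \<omega> $ i $ j - A $ i $ j)\<^sup>2) \<partial>M)"
    if [measurable]: "\<And>i j. (\<lambda>\<omega>. Y \<omega> $ i $ j) \<in> borel_measurable M" for Y :: "'a \<Rightarrow> real^'p^'p"
    by (simp add: frob_sq sum_nonneg nn_integral_sum flip: sum_ennreal)
  have "(\<integral>\<^sup>+\<omega>. ennreal ((Sigma_RBLW n X \<omega> $ i $ j - A $ i $ j)\<^sup>2) \<partial>M)
      \<le> (\<integral>\<^sup>+\<omega>. ennreal ((Sigma_LW n X \<omega> $ i $ j - A $ i $ j)\<^sup>2) \<partial>M)" for i j
  proof -
    have "(\<integral>\<^sup>+\<omega>. ennreal ((Sigma_RBLW n X \<omega> $ i $ j - A $ i $ j)\<^sup>2) \<partial>M)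
       = (\<integral>\<^sup>+\<omega>. ennreal ((real_cond_exp M F_Shat (\<lambda>\<eta>. Sigma_LW n X \<eta> $ i $ j) \<omega> - A $ i $ j)\<^sup>2) \<partial>M)"
      using real_cond_exp_Sigma_LW[OF assms, of i j]
      by (intro nn_integral_cong_AE) (auto elim!: eventually_mono)
    then show ?thesis
      using nn_integral_real_cond_exp_diff_sq_le[OF borel_measurable_Sigma_LW finite_measure_axioms] by simp
  qed
  then show ?thesis by (simp add: frob sum_mono)
qed

end

section \<open>The normal density and the conclusion for normal samples\<close>

lemma mvn_density_rot45:
  "ennreal (mvn_density Sig ((1 / sqrt 2) *\<^sub>R (x + y))) * ennreal (mvn_density Sig ((1 / sqrt 2) *\<^sub>R (x - y)))
    = ennreal (mvn_density Sig x) * ennreal (mvn_density Sig y)"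
proof -
  define q where "q v = v \<bullet> (matrix_inv Sig *v v)" for v
  define c where "c = sqrt ((2 * pi) ^ CARD('a) * det Sig)"
  have mvn: "mvn_density Sig v = exp (- q v / 2) / c" for v
    by (simp add: mvn_density_def q_def c_def)
  \<comment> \<open>Parallelogram law for the quadratic form in the exponent; the mixed terms cancel
    in pairs.\<close>
  have "q ((1 / sqrt 2) *\<^sub>R (x + y)) + q ((1 / sqrt 2) *\<^sub>R (x - y)) = q x + q y"
    by (simp add: q_def scaleR_matrix_vector_assoc[symmetric] matrix_vector_mult_scaleR
        matrix_vector_right_distrib matrix_vector_mult_diff_distrib inner_add_left inner_add_right
        inner_diff_left inner_diff_right field_simps)
  then have e: "exp (- q ((1 / sqrt 2) *\<^sub>R (x + y)) / 2) * exp (- q ((1 / sqrt 2) *\<^sub>R (x - y)) / 2)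
      = exp (- q x / 2) * exp (- q y / 2)"
    unfolding exp_add[symmetric] by (simp add: field_simps)
  show ?thesis
  proof (cases "c > 0")
    case True
    have "mvn_density Sig ((1 / sqrt 2) *\<^sub>R (x + y)) * mvn_density Sig ((1 / sqrt 2) *\<^sub>R (x - y))
        = mvn_density Sig x * mvn_density Sig y"
      unfolding mvn times_divide_times_eq e ..
    moreover have "mvn_density Sig v \<ge> 0" for v using True by (simp add: mvn)
    ultimately show ?thesis by (simp flip: ennreal_mult)
  next
    \<comment> \<open>For nonpositive \<open>c\<close> the quotient is nonpositive, or 0 by division
      by zero, and \<open>ennreal\<close> truncates it to 0 on both sides.\<close>
    case False
    then have "ennreal (mvn_density Sig v) = 0" for v
      by (simp add: mvn ennreal_eq_0_iff divide_nonneg_nonpos)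
    then show ?thesis by simp
  qed
qed

theorem theorem2:
  fixes M :: "'a measure" and X :: "nat \<Rightarrow> 'a \<Rightarrow> real^'p"
    and Sig :: "real^'p^'p" and n :: nat
  assumes "prob_space M"
    and "CARD('p) \<ge> 2" and "n \<ge> 1"
    and "sym_posdef Sig"
    and "\<forall>i<n. distributed M lborel (X i) (\<lambda>x. ennreal (mvn_density Sig x))"
    and "prob_space.indep_vars M (\<lambda>_. borel) X {..<n}"
  shows "(AE \<omega> in M. \<forall>i j.
            real_cond_exp M (vimage_algebra (space M) (Shat n X) borel)
              (\<lambda>\<eta>. Sigma_LW n X \<eta> $ i $ j) \<omega> = Sigma_RBLW n X \<omega> $ i $ j)
       \<and> (\<integral>\<^sup>+\<omega>. ennreal ((frob (Sigma_RBLW n X \<omega> - Sig))^2) \<partial>M)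
           \<le> (\<integral>\<^sup>+\<omega>. ennreal ((frob (Sigma_LW n X \<omega> - Sig))^2) \<partial>M)"
proof -
  interpret prob_space M by fact
  let ?f = "\<lambda>x. ennreal (mvn_density Sig x)"
  let ?I = "PiM {..<n} (\<lambda>_. borel :: (real^'p) measure)"
  let ?x = "\<lambda>\<omega>. \<lambda>k\<in>{..<n}. X k \<omega>"
  have X: "X i \<in> borel_measurable M" if "i < n" for i
    using distributed_measurable[of M lborel "X i" ?f] assms(5) that by simp
  have distr: "distr M borel (X i) = density lborel ?f" if "i < n" for i
  proof -
    have "distr M borel (X i) = distr M lborel (X i)"
      by (rule distr_cong) auto
    with assms(5) that show ?thesis by (auto simp: distributed_distr_eq_density)
  qed
  \<comment> \<open>As n \<ge> 1 there is an observation with index 0; it yields measurability of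
    the density and, next, its total mass 1.\<close>
  have f: "?f \<in> borel_measurable borel"
    using distributed_borel_measurable[of M lborel "X 0" ?f] assms(3,5) by simp
  have N: "prob_space (density lborel ?f)"
    using assms(3) prob_space_distr[OF X[of 0]] distr[of 0] by simp
  have x: "?x \<in> measurable M ?I"
    by (intro measurable_restrict) (auto intro: X)
  \<comment> \<open>Independence enters here, as the product form of the joint law; the index set is
    nonempty because n \<ge> 1.\<close>
  have "distr M ?I ?x = PiM {..<n} (\<lambda>i. distr M borel (X i))"
    using assms(3,6) X by (subst indep_vars_iff_distr_eq_PiM'[symmetric]) (auto simp: lessThan_empty_iff)
  also have "\<dots> = PiM {..<n} (\<lambda>_. density lborel ?f)"
    by (intro PiM_cong) (auto simp: distr)
  finally have joint: "distr M ?I ?x = PiM {..<n} (\<lambda>_. density lborel ?f)" .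
  interpret rot45_invariant_sample M X n
  proof
    fix i j assume ij: "i < n" "j < n" "i \<noteq> j"
    have "distr M ?I (\<lambda>\<omega>. rot45 i j (?x \<omega>)) = distr (distr M ?I ?x) ?I (rot45 i j)"
      using ij by (subst distr_distr[OF measurable_rot45 x]) (auto simp: comp_def)
    also have "\<dots> = distr M ?I ?x"
      unfolding joint using ij by (intro distr_PiM_rot45 f N mvn_density_rot45) auto
    finally show "distr M ?I (\<lambda>\<omega>. rot45 i j (?x \<omega>)) = distr M ?I ?x" .
  qed (rule X)
  have "n > 0" using assms(3) by simp
  then show ?thesis
    using real_cond_exp_Sigma_LW risk_Sigma_RBLW_le by (simp add: AE_all_countable)
qed

end
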